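(* Let $(A,\cdot,\ast,\alpha)$ be a multiplicative Hom-Novikov-Poisson algebra and let $a\in A$ be an element such that $\alpha^2(a)=a$. Then $A'=(A,\diamond,\ast_\alpha,\alpha^2)$ is also a multiplicative Hom-Novikov-Poisson algebra, where \[ x\diamond y=a\cdot(x\cdot y),\qquad x\ast_\alpha y=\alpha(x\ast y)=\alpha(x)\ast\alpha(y) \] for all $x,y\in A$.
   Context: Everything is over a fixed field $\mathbf{k}$ of characteristic $0$. A double Hom-algebra is a quadruple $(A,\cdot,\ast,\alpha)$ where $A$ is a $\mathbf{k}$-vector space, $\cdot$ and $\ast$ are bilinear operations $A\otimes A\to A$, and $\alpha\colon A\to A$ is a linear map (the twisting map). It is multiplicative if $\alpha(x\cdot y)=\alpha(x)\cdot\alpha(y)$ and $\alpha(x\ast y)=\alpha(x)\ast\alpha(y)$ for all $x,y$. $\alpha^n$ denotes the $n$-fold composition of $\alpha$. A Hom-Novikov-Poisson algebra is a double Hom-algebra $(A,\cdot,\ast,\alpha)$ such that for all $x,y,z\in A$: (1) $(A,\cdot,\alpha)$ is a commutative Hom-associative algebra: $x\cdot y=y\cdot x$ and $(x\cdot y)\cdot\alpha(z)=\alpha(x)\cdot(y\cdot z)$; (2) $(A,\ast,\alpha)$ is a Hom-Novikov algebra: $(x\ast y)\ast\alpha(z)-\alpha(x)\ast(y\ast z)=(y\ast x)\ast\alpha(z)-\alpha(y)\ast(x\ast z)$ and $(x\ast y)\ast\alpha(z)=(x\ast z)\ast\alpha(y)$; (3) $(x\ast y)\cdot\alpha(z)-\alpha(x)\ast(y\cdot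 z)=(y\ast x)\cdot\alpha(z)-\alpha(y)\ast(x\cdot z)$; (4) $(x\cdot y)\ast\alpha(z)=(x\ast z)\cdot\alpha(y)$. *)

theory Defs
  imports Complex_Main
begin

text \<open>
  The underlying vector space is a type \<open>'a\<close> with a scalar multiplication \<open>scale\<close> by the field \<open>'k\<close>;
  the fixed ground field of characteristic 0 is expressed by the class \<open>field_char_0\<close>.
\<close>

definition bilinear_op :: "('k::field \<Rightarrow> 'a::ab_group_add \<Rightarrow> 'a) \<Rightarrow> ('a \<Rightarrow> 'a \<Rightarrow> 'a) \<Rightarrow> bool" where
  "bilinear_op scale f \<longleftrightarrow>
    (\<forall>x. Vector_Spaces.linear scale scale (\<lambda>y. f x y)) \<and>
    (\<forall>y. Vector_Spaces.linear scale scale (\<lambda>x. f x y))"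

locale hom_algebra = vector_space scale
  for scale :: "'k::field_char_0 \<Rightarrow> 'a::ab_group_add \<Rightarrow> 'a" +
  fixes mult :: "'a \<Rightarrow> 'a \<Rightarrow> 'a"  (infixl \<open>\<cdot>\<close> 70)
    and \<alpha> :: "'a \<Rightarrow> 'a"
  assumes bilinear: "bilinear_op scale (\<cdot>)"
    and linear_twist: "Vector_Spaces.linear scale scale \<alpha>"

locale comm_hom_associative_algebra = hom_algebra +
  assumes comm: "x \<cdot> y = y \<cdot> x"
    and hom_assoc: "(x \<cdot> y) \<cdot> \<alpha> z = \<alpha> x \<cdot> (y \<cdot> z)"

locale hom_novikov_algebra = hom_algebra scale star \<alpha>
  for scale :: "'k::field_char_0 \<Rightarrow> 'a::ab_group_add \<Rightarrow> 'a"
    and star :: "'a \<Rightarrow> 'a \<Rightarrow> 'a"  (infixl \<open>\<star>\<close> 70)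
    and \<alpha> :: "'a \<Rightarrow> 'a" +
  assumes left_symmetric:
      "(x \<star> y) \<star> \<alpha> z - \<alpha> x \<star> (y \<star> z) = (y \<star> x) \<star> \<alpha> z - \<alpha> y \<star> (x \<star> z)"
    and right_commutative: "(x \<star> y) \<star> \<alpha> z = (x \<star> z) \<star> \<alpha> y"

locale double_hom_algebra =
  dot: hom_algebra scale mult \<alpha> + star: hom_algebra scale star \<alpha>
  for scale :: "'k::field_char_0 \<Rightarrow> 'a::ab_group_add \<Rightarrow> 'a"
    and mult :: "'a \<Rightarrow> 'a \<Rightarrow> 'a"  (infixl \<open>\<cdot>\<close> 70)
    and star :: "'a \<Rightarrow> 'a \<Rightarrow> 'a"  (infixl \<open>\<star>\<close> 70)
    and \<alpha> :: "'a \<Rightarrow> 'a"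

locale multiplicative_double_hom_algebra = double_hom_algebra +
  assumes twist_mult: "\<alpha> (x \<cdot> y) = \<alpha> x \<cdot> \<alpha> y"
    and twist_star: "\<alpha> (x \<star> y) = \<alpha> x \<star> \<alpha> y"

locale hom_novikov_poisson_algebra =
  double_hom_algebra scale mult star \<alpha> +
  dot: comm_hom_associative_algebra scale mult \<alpha> +
  star: hom_novikov_algebra scale star \<alpha>
  for scale :: "'k::field_char_0 \<Rightarrow> 'a::ab_group_add \<Rightarrow> 'a"
    and mult :: "'a \<Rightarrow> 'a \<Rightarrow> 'a"  (infixl \<open>\<cdot>\<close> 70)
    and star :: "'a \<Rightarrow> 'a \<Rightarrow> 'a"  (infixl \<open>\<star>\<close> 70)
    and \<alpha> :: "'a \<Rightarrow> 'a" +
  assumes compat_left: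
      "(x \<star> y) \<cdot> \<alpha> z - \<alpha> x \<star> (y \<cdot> z) = (y \<star> x) \<cdot> \<alpha> z - \<alpha> y \<star> (x \<cdot> z)"
    and compat_right: "(x \<cdot> y) \<star> \<alpha> z = (x \<star> z) \<cdot> \<alpha> y"

locale multiplicative_hom_novikov_poisson_algebra =
  hom_novikov_poisson_algebra scale mult star \<alpha> +
  multiplicative_double_hom_algebra scale mult star \<alpha>
  for scale :: "'k::field_char_0 \<Rightarrow> 'a::ab_group_add \<Rightarrow> 'a"
    and mult :: "'a \<Rightarrow> 'a \<Rightarrow> 'a"  (infixl \<open>\<cdot>\<close> 70)
    and star :: "'a \<Rightarrow> 'a \<Rightarrow> 'a"  (infixl \<open>\<star>\<close> 70)
    and \<alpha> :: "'a \<Rightarrow> 'a"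

end

theory Submission
  imports Defs
begin

text \<open>
  The operation \<open>\<alpha> (x \<star> y)\<close> is the Yau twist of \<open>\<star>\<close>: by multiplicativity, both sides of each
  Hom-Novikov identity for \<open>\<alpha> (x \<star> y)\<close> and \<open>\<alpha>\<^sup>2\<close> are the images under \<open>\<alpha>\<^sup>2\<close> of the two sides of the
  original identity.

  For \<open>a \<cdot> (x \<cdot> y)\<close>, Hom-associativity and commutativity of \<open>\<cdot>\<close> suffice to move the two factors \<open>a\<close>
  of an iterated product to the front, so Hom-associativity is inherited. The condition \<open>\<alpha>\<^sup>2 a = a\<close>
  makes \<open>\<alpha>\<^sup>2\<close> multiplicative for the new product. It also makes \<open>a\<close> the image of \<open>\<alpha> a\<close> under \<open>\<alpha>\<close>, so
  that \<open>a\<close> can take the place of the twisted argument in the axioms that link \<open>\<cdot>\<close> with \<open>\<star>\<close>.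

  The only axiom that is not immediate is the left compatibility. Writing \<open>x'\<close> for \<open>\<alpha> x\<close>, put
  \<open>P(x,y,z) = (x \<star> y) \<cdot> z' - x' \<star> (y \<cdot> z)\<close>, whose symmetry in \<open>x\<close> and \<open>y\<close> is the original axiom; the
  corresponding expression in the new structure turns out to be
  \<open>a \<cdot> P(x',y',z') + P(y',x',a) \<cdot> z'''\<close>, in which both summands are symmetric
  (\<open>compat_left_defect_perturbed\<close>).
\<close>

context hom_algebra
begin

lemma linear_mult_left: "Vector_Spaces.linear scale scale (\<lambda>y. x \<cdot> y)"
  and linear_mult_right: "Vector_Spaces.linear scale scale (\<lambda>x. x \<cdot> y)"
  using bilinear by (auto simp: bilinear_op_def)

lemma mult_diff_right: "x \<cdot> (y - z) = x \<cdot> y - x \<cdot> z"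
  using linear_mult_left[of x] by (simp add: linear_iff_module_hom module_hom.diff)

lemma mult_diff_left: "(x - y) \<cdot> z = x \<cdot> z - y \<cdot> z"
  using module_hom.diff[OF linear_mult_right[of z, unfolded linear_iff_module_hom]] .

lemma twist_diff: "\<alpha> (x - y) = \<alpha> x - \<alpha> y"
  using linear_twist by (simp add: linear_iff_module_hom module_hom.diff)

text \<open>
  Both new operations have this form: \<open>f\<close> is multiplication by \<open>a\<close> for one and the twisting map for
  the other.
\<close>

lemma hom_algebra_compose_linear:
  assumes "Vector_Spaces.linear scale scale f"
  shows "hom_algebra scale (\<lambda>x y. f (x \<cdot> y)) (\<alpha> ^^ 2)"
proof (intro hom_algebra.intro hom_algebra_axioms.intro)
  show "vector_space scale"
    by (rule vector_space_axioms)
  show "bilinear_op scale (\<lambda>x y. f (x \<cdot> y))"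
    using Vector_Spaces.linear_compose[OF linear_mult_left assms]
      Vector_Spaces.linear_compose[OF linear_mult_right assms]
    by (simp add: bilinear_op_def comp_def)
  show "Vector_Spaces.linear scale scale (\<alpha> ^^ 2)"
    using Vector_Spaces.linear_compose[OF linear_twist linear_twist]
    by (simp add: numeral_2_eq_2 comp_def)
qed

end

context comm_hom_associative_algebra
begin

text \<open>
  Both iterated products equal \<open>a \<cdot> (\<alpha> a \<cdot> (\<alpha> x \<cdot> (y \<cdot> z)))\<close>: inside the outer factor \<open>a\<close>, each is two
  applications of Hom-associativity away.
\<close>

lemma comm_hom_associative_perturbed:
  "comm_hom_associative_algebra scale (\<lambda>x y. a \<cdot> (x \<cdot> y)) (\<alpha> ^^ 2)"
proof (intro comm_hom_associative_algebra.intro comm_hom_associative_algebra_axioms.intro)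
  show "hom_algebra scale (\<lambda>x y. a \<cdot> (x \<cdot> y)) (\<alpha> ^^ 2)"
    by (rule hom_algebra_compose_linear[OF linear_mult_left])
next
  fix x y
  show "a \<cdot> (x \<cdot> y) = a \<cdot> (y \<cdot> x)"
    by (simp only: comm)
next
  fix x y z
  have "(a \<cdot> (x \<cdot> y)) \<cdot> \<alpha> (\<alpha> z) = \<alpha> a \<cdot> (\<alpha> x \<cdot> (y \<cdot> z))"
    by (simp only: hom_assoc)
  moreover have "\<alpha> (\<alpha> x) \<cdot> (a \<cdot> (y \<cdot> z)) = \<alpha> a \<cdot> (\<alpha> x \<cdot> (y \<cdot> z))"
    by (metis comm hom_assoc)
  ultimately show "a \<cdot> ((a \<cdot> (x \<cdot> y)) \<cdot> (\<alpha> ^^ 2) z) = a \<cdot> ((\<alpha> ^^ 2) x \<cdot> (a \<cdot> (y \<cdot> z)))"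
    by (simp add: numeral_2_eq_2)
qed

end

context multiplicative_hom_novikov_poisson_algebra
begin

lemma hom_novikov_yau_twist: "hom_novikov_algebra scale (\<lambda>x y. \<alpha> (x \<star> y)) (\<alpha> ^^ 2)"
proof (intro hom_novikov_algebra.intro hom_novikov_algebra_axioms.intro)
  show "hom_algebra scale (\<lambda>x y. \<alpha> (x \<star> y)) (\<alpha> ^^ 2)"
    by (rule star.hom_algebra_compose_linear[OF dot.linear_twist])
next
  fix x y z
  have "\<alpha> (\<alpha> ((x \<star> y) \<star> \<alpha> z - \<alpha> x \<star> (y \<star> z))) = \<alpha> (\<alpha> ((y \<star> x) \<star> \<alpha> z - \<alpha> y \<star> (x \<star> z)))"
    by (simp only: star.left_symmetric)
  then show "\<alpha> (\<alpha> (x \<star> y) \<star> (\<alpha> ^^ 2) z) - \<alpha> ((\<alpha> ^^ 2) x \<star> \<alpha> (y \<star> z)) =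
      \<alpha> (\<alpha> (y \<star> x) \<star> (\<alpha> ^^ 2) z) - \<alpha> ((\<alpha> ^^ 2) y \<star> \<alpha> (x \<star> z))"
    by (simp add: numeral_2_eq_2 twist_star dot.twist_diff)
next
  fix x y z
  have "\<alpha> (\<alpha> ((x \<star> y) \<star> \<alpha> z)) = \<alpha> (\<alpha> ((x \<star> z) \<star> \<alpha> y))"
    by (simp only: star.right_commutative)
  then show "\<alpha> (\<alpha> (x \<star> y) \<star> (\<alpha> ^^ 2) z) = \<alpha> (\<alpha> (x \<star> z) \<star> (\<alpha> ^^ 2) y)"
    by (simp add: numeral_2_eq_2 twist_star)
qed

lemma compat_right_perturbed:
  assumes a: "\<alpha> (\<alpha> a) = a"
  shows "\<alpha> ((a \<cdot> (x \<cdot> y)) \<star> \<alpha> (\<alpha> z)) = a \<cdot> (\<alpha> (x \<star> z) \<cdot> \<alpha> (\<alpha> y))"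
proof -
  have "(a \<cdot> (x \<cdot> y)) \<star> \<alpha> (\<alpha> z) = ((x \<cdot> y) \<star> \<alpha> z) \<cdot> \<alpha> a"
    by (simp only: compat_right dot.comm[of a])
  also have "\<dots> = \<alpha> a \<cdot> ((x \<star> z) \<cdot> \<alpha> y)"
    by (simp only: compat_right dot.comm)
  finally show ?thesis
    by (simp add: twist_mult a)
qed

text \<open>
  The shape of the right-hand side makes its symmetry in \<open>x\<close> and \<open>y\<close> visible: left compatibility
  applies to each of the two differences. To reach it, rewrite the subtracted term as
  \<open>\<alpha> (\<alpha> (\<alpha> x)) \<star> ((\<alpha> y \<cdot> \<alpha> z) \<cdot> \<alpha> a)\<close> and expand it by left compatibility for the pair
  \<open>\<alpha> (\<alpha> x)\<close>, \<open>\<alpha> y \<cdot> \<alpha> z\<close>. One of the three resulting terms completes the first summand; the other two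
  acquire the common factor \<open>\<alpha> (\<alpha> (\<alpha> z))\<close> by right compatibility and Hom-associativity.
\<close>

lemma compat_left_defect_perturbed:
  assumes a: "\<alpha> (\<alpha> a) = a"
  shows "a \<cdot> (\<alpha> (x \<star> y) \<cdot> \<alpha> (\<alpha> z)) - \<alpha> (\<alpha> (\<alpha> x) \<star> (a \<cdot> (y \<cdot> z))) =
    a \<cdot> ((\<alpha> x \<star> \<alpha> y) \<cdot> \<alpha> (\<alpha> z) - \<alpha> (\<alpha> x) \<star> (\<alpha> y \<cdot> \<alpha> z)) +
    ((\<alpha> y \<star> \<alpha> x) \<cdot> \<alpha> a - \<alpha> (\<alpha> y) \<star> (\<alpha> x \<cdot> a)) \<cdot> \<alpha> (\<alpha> (\<alpha> z))"
proof -
  have "(\<alpha> (\<alpha> x) \<star> (\<alpha> y \<cdot> \<alpha> z)) \<cdot> a - \<alpha> (\<alpha> (\<alpha> x)) \<star> ((\<alpha> y \<cdot> \<alpha> z) \<cdot> \<alpha> a) =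
      ((\<alpha> y \<cdot> \<alpha> z) \<star> \<alpha> (\<alpha> x)) \<cdot> a - \<alpha> (\<alpha> y \<cdot> \<alpha> z) \<star> (\<alpha> (\<alpha> x) \<cdot> \<alpha> a)"
    using compat_left[of "\<alpha> (\<alpha> x)" "\<alpha> y \<cdot> \<alpha> z" "\<alpha> a"] by (simp only: a)
  moreover have "((\<alpha> y \<cdot> \<alpha> z) \<star> \<alpha> (\<alpha> x)) \<cdot> a = ((\<alpha> y \<star> \<alpha> x) \<cdot> \<alpha> a) \<cdot> \<alpha> (\<alpha> (\<alpha> z))"
  proof -
    have "((\<alpha> y \<cdot> \<alpha> z) \<star> \<alpha> (\<alpha> x)) \<cdot> a = ((\<alpha> y \<star> \<alpha> x) \<cdot> \<alpha> (\<alpha> z)) \<cdot> \<alpha> (\<alpha> a)"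
      by (simp only: compat_right a)
    also have "\<dots> = \<alpha> (\<alpha> y \<star> \<alpha> x) \<cdot> (\<alpha> a \<cdot> \<alpha> (\<alpha> z))"
      by (simp only: dot.hom_assoc dot.comm[of "\<alpha> a"])
    finally show ?thesis
      by (simp only: dot.hom_assoc)
  qed
  moreover have "\<alpha> (\<alpha> y \<cdot> \<alpha> z) \<star> (\<alpha> (\<alpha> x) \<cdot> \<alpha> a) =
      (\<alpha> (\<alpha> y) \<star> (\<alpha> x \<cdot> a)) \<cdot> \<alpha> (\<alpha> (\<alpha> z))"
    by (simp only: twist_mult[of "\<alpha> y"] twist_mult[of "\<alpha> x" a, symmetric] compat_right)
  moreover have "\<alpha> (\<alpha> (\<alpha> x) \<star> (a \<cdot> (y \<cdot> z))) = \<alpha> (\<alpha> (\<alpha> x)) \<star> ((\<alpha> y \<cdot> \<alpha> z) \<cdot> \<alpha> a)"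
    by (simp only: twist_star twist_mult dot.comm[of "\<alpha> a"])
  ultimately show ?thesis
    by (simp add: dot.mult_diff_left dot.mult_diff_right twist_star dot.comm[of a] algebra_simps)
qed

theorem multiplicative_hom_novikov_poisson_perturbed:
  assumes a: "\<alpha> (\<alpha> a) = a"
  shows "multiplicative_hom_novikov_poisson_algebra scale
    (\<lambda>x y. a \<cdot> (x \<cdot> y)) (\<lambda>x y. \<alpha> (x \<star> y)) (\<alpha> ^^ 2)"
proof -
  interpret new_dot: comm_hom_associative_algebra scale "\<lambda>x y. a \<cdot> (x \<cdot> y)" "\<alpha> ^^ 2"
    by (rule dot.comm_hom_associative_perturbed)
  interpret new_star: hom_novikov_algebra scale "\<lambda>x y. \<alpha> (x \<star> y)" "\<alpha> ^^ 2"
    by (rule hom_novikov_yau_twist)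
  show ?thesis
  proof unfold_locales
    fix x y z
    have "(\<alpha> x \<star> \<alpha> y) \<cdot> \<alpha> (\<alpha> z) - \<alpha> (\<alpha> x) \<star> (\<alpha> y \<cdot> \<alpha> z) =
        (\<alpha> y \<star> \<alpha> x) \<cdot> \<alpha> (\<alpha> z) - \<alpha> (\<alpha> y) \<star> (\<alpha> x \<cdot> \<alpha> z)"
      by (rule compat_left)
    moreover have "(\<alpha> y \<star> \<alpha> x) \<cdot> \<alpha> a - \<alpha> (\<alpha> y) \<star> (\<alpha> x \<cdot> a) =
        (\<alpha> x \<star> \<alpha> y) \<cdot> \<alpha> a - \<alpha> (\<alpha> x) \<star> (\<alpha> y \<cdot> a)"
      by (rule compat_left)
    ultimately show "a \<cdot> (\<alpha> (x \<star> y) \<cdot> (\<alpha> ^^ 2) z) - \<alpha> ((\<alpha> ^^ 2) x \<star> (a \<cdot> (y \<cdot> z))) =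
        a \<cdot> (\<alpha> (y \<star> x) \<cdot> (\<alpha> ^^ 2) z) - \<alpha> ((\<alpha> ^^ 2) y \<star> (a \<cdot> (x \<cdot> z)))"
      by (simp only: numeral_2_eq_2 funpow.simps comp_apply id_apply
          compat_left_defect_perturbed[OF a])
  next
    fix x y z
    show "\<alpha> ((a \<cdot> (x \<cdot> y)) \<star> (\<alpha> ^^ 2) z) = a \<cdot> (\<alpha> (x \<star> z) \<cdot> (\<alpha> ^^ 2) y)"
      using compat_right_perturbed[OF a] by (simp add: numeral_2_eq_2)
  next
    fix x y
    show "(\<alpha> ^^ 2) (a \<cdot> (x \<cdot> y)) = a \<cdot> ((\<alpha> ^^ 2) x \<cdot> (\<alpha> ^^ 2) y)"
      by (simp add: numeral_2_eq_2 twist_mult a)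
    show "(\<alpha> ^^ 2) (\<alpha> (x \<star> y)) = \<alpha> ((\<alpha> ^^ 2) x \<star> (\<alpha> ^^ 2) y)"
      by (simp add: numeral_2_eq_2 twist_star)
  qed
qed

end

theorem theorem4p2:
  fixes scale :: "'k::field_char_0 \<Rightarrow> 'a::ab_group_add \<Rightarrow> 'a"
    and mult :: "'a \<Rightarrow> 'a \<Rightarrow> 'a"  (infixl \<open>\<cdot>\<close> 70)
    and star :: "'a \<Rightarrow> 'a \<Rightarrow> 'a"  (infixl \<open>\<star>\<close> 70)
    and \<alpha> :: "'a \<Rightarrow> 'a"
    and a :: 'a
  assumes "multiplicative_hom_novikov_poisson_algebra scale (\<cdot>) (\<star>) \<alpha>"
    and "(\<alpha> ^^ 2) a = a"
  shows "(\<forall>x y. \<alpha> (x \<star> y) = \<alpha> x \<star> \<alpha> y) \<and>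
    multiplicative_hom_novikov_poisson_algebra scale
      (\<lambda>x y. a \<cdot> (x \<cdot> y)) (\<lambda>x y. \<alpha> (x \<star> y)) (\<alpha> ^^ 2)"
proof -
  interpret multiplicative_hom_novikov_poisson_algebra scale "(\<cdot>)" "(\<star>)" \<alpha>
    by (rule assms(1))
  from assms(2) have "\<alpha> (\<alpha> a) = a"
    by (simp add: numeral_2_eq_2)
  then show ?thesis
    using twist_star multiplicative_hom_novikov_poisson_perturbed by blast
qed

end
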